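(* Let $C$ and $C'$ be proper open convex cones in finite-dimensional real vector spaces, and let $\phi\colon C\to C'$ be a surjective isometry of the Thompson metric. Then there exist decompositions $C=C_1\oplus C_2$ and $C'=C'_1\oplus C'_2$ such that $\phi$ takes the form $$\phi(x_1+x_2)=\phi_1(x_1)+\phi_2(x_2)\qquad\text{for all } x_1\in C_1,\ x_2\in C_2,$$ where $\phi_1$ is a gauge-preserving map from $C_1$ to $C'_1$, and $\phi_2$ is a gauge-reversing map from $C_2$ to $C'_2$.
   Context: A proper open convex cone $C$ in a finite-dimensional real vector space $V$ is a non-empty open convex set, invariant under multiplication by positive scalars, with $\overline{C}\cap(-\overline{C})=\{0\}$. Write $x\le_C y$ if $y-x\in\overline{C}$, and let the gauge be $M_C(x,y):=\inf\{\lambda>0 \mid x\le_C\lambda y\}$ for $x,y\in C$. Thompson's metric on $C$ is $d_T(x,y):=\log\max\big(M_C(x,y),M_C(y,x)\big)$. For non-empty convex cones $C_1,C_2,C$ in a vector space, $C=C_1\oplus C_2$ (direct product) means $C=C_1+C_2$ and $\operatorname{lin}C_1\cap\operatorname{lin}C_2=\{0\}$, where $\operatorname{lin}$ denotes linear span. Here each $C_i$ is regarded as an open cone in $\operatorname{lin}C_i$ (and similarly for $C_i'$), with its own gauge $M_{C_i}$. A factor may be the trivial cone $\{0\}$, in which case the map $\{0\}\to\{0\}$ counts as both gauge-preserving and gauge-reversing. A map $\phi\colon C\to C'$ between cones is gauge-preserving if $M_{C'}(\phi(x),\phi(y))=M_C(x,y)$ for all $x,y\in C$, and gauge-reversing if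 $M_{C'}(\phi(x),\phi(y))=M_C(y,x)$ for all $x,y\in C$. *)

theory Defs
  imports "HOL-Analysis.Analysis"
begin

(* The library's cone, conic and convex_cone all force 0 to be a member, so that an open proper
   cone would be excluded: here only invariance under positive scalars is wanted. *)
definition pos_convex_cone :: "'a::real_vector set \<Rightarrow> bool" where
  "pos_convex_cone C \<longleftrightarrow> C \<noteq> {} \<and> convex C \<and> (\<forall>x\<in>C. \<forall>c>0. c *\<^sub>R x \<in> C)"

(* The finite-dimensional space is a linear subspace V of a Euclidean space, and "open" means open
   in V. This covers the zero space (no euclidean_space type has dimension 0), and cones in their
   own linear span. Since V is closed, the closure taken in the ambient type is the one in V. *)
definition proper_open_cone :: "'a::euclidean_space set \<Rightarrow> 'a set \<Rightarrow> bool" where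
  "proper_open_cone V C \<longleftrightarrow>
     pos_convex_cone C \<and> openin (top_of_set V) C \<and> closure C \<inter> uminus ` closure C = {0}"

definition cone_le :: "'a::real_normed_vector set \<Rightarrow> 'a \<Rightarrow> 'a \<Rightarrow> bool" where
  "cone_le C x y \<longleftrightarrow> y - x \<in> closure C"

(* On the trivial cone {0} this gives M(0,0) = 0, so the map {0} \<rightarrow> {0} is both
   gauge-preserving and gauge-reversing. *)
definition gauge_M :: "'a::real_normed_vector set \<Rightarrow> 'a \<Rightarrow> 'a \<Rightarrow> real" where
  "gauge_M C x y = Inf {l. l > 0 \<and> cone_le C x (l *\<^sub>R y)}"

(* On the trivial cone {0} this reads ln 0, which is 0: the distance of the point to itself. *)
definition thompson_dist :: "'a::real_normed_vector set \<Rightarrow> 'a \<Rightarrow> 'a \<Rightarrow> real" where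
  "thompson_dist C x y = ln (max (gauge_M C x y) (gauge_M C y x))"

definition thompson_isometry ::
    "'a::real_normed_vector set \<Rightarrow> 'b::real_normed_vector set \<Rightarrow> ('a \<Rightarrow> 'b) \<Rightarrow> bool" where
  "thompson_isometry C C' \<phi> \<longleftrightarrow>
     \<phi> \<in> C \<rightarrow> C' \<and> (\<forall>x\<in>C. \<forall>y\<in>C. thompson_dist C' (\<phi> x) (\<phi> y) = thompson_dist C x y)"

definition gauge_preserving ::
    "'a::real_normed_vector set \<Rightarrow> 'b::real_normed_vector set \<Rightarrow> ('a \<Rightarrow> 'b) \<Rightarrow> bool" where
  "gauge_preserving C C' \<phi> \<longleftrightarrow>
     \<phi> \<in> C \<rightarrow> C' \<and> (\<forall>x\<in>C. \<forall>y\<in>C. gauge_M C' (\<phi> x) (\<phi> y) = gauge_M C x y)"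

definition gauge_reversing ::
    "'a::real_normed_vector set \<Rightarrow> 'b::real_normed_vector set \<Rightarrow> ('a \<Rightarrow> 'b) \<Rightarrow> bool" where
  "gauge_reversing C C' \<phi> \<longleftrightarrow>
     \<phi> \<in> C \<rightarrow> C' \<and> (\<forall>x\<in>C. \<forall>y\<in>C. gauge_M C' (\<phi> x) (\<phi> y) = gauge_M C y x)"

(* The sum of sets is the Minkowski sum. *)
definition direct_product :: "'a::real_vector set \<Rightarrow> 'a set \<Rightarrow> 'a set \<Rightarrow> bool" where
  "direct_product C C1 C2 \<longleftrightarrow>
     pos_convex_cone C \<and> pos_convex_cone C1 \<and> pos_convex_cone C2 \<and>
     C = C1 + C2 \<and> span C1 \<inter> span C2 = {0}"

end

theory Submission
  imports Defs
begin

text \<open>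
  The point \<open>x\<close> is the only point at distance at most \<open>ln l\<close> from both \<open>l x\<close> and \<open>x / l\<close>, and
  a suitable positive combination of two points is always a point in between them. Hence an
  isometry \<open>\<phi>\<close> must satisfy \<open>\<phi> (l x) = l u(x) + v(x) / l\<close>. All \<open>u(x)\<close> are comparable with each
  other, and so are all \<open>v(x)\<close>; uniqueness of the midpoint forces the spans of these two families
  to be independent, and \<open>C' = u(C) + v(C)\<close>. The inverse isometry decomposes \<open>C\<close> in the same way.
  Combining the two, \<open>\<phi> (s x1 + r x2) = s u + v / r\<close> whenever \<open>\<phi> (x1 + x2) = u + v\<close>, and letting
  \<open>s\<close> or \<open>r\<close> tend to infinity isolates the gauge of each of the factors.
\<close>

section \<open>Gauges of proper open cones\<close>

locale open_cone =
  fixes V C :: "'a::euclidean_space set"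
  assumes subspace_V: "subspace V" and proper: "proper_open_cone V C"
begin

lemma convex_cone: "pos_convex_cone C"
  using proper by (simp add: proper_open_cone_def)

lemma nonempty: "C \<noteq> {}"
  using convex_cone by (simp add: pos_convex_cone_def)

lemma scale: "x \<in> C \<Longrightarrow> c > 0 \<Longrightarrow> c *\<^sub>R x \<in> C"
  using convex_cone by (simp add: pos_convex_cone_def)

lemma add:
  assumes "x \<in> C" "y \<in> C" shows "x + y \<in> C"
proof -
  have "(1/2) *\<^sub>R x + (1/2) *\<^sub>R y \<in> C"
    using convex_cone assms unfolding pos_convex_cone_def by (intro convexD) auto
  from scale[OF this, of 2] show ?thesis by (simp add: scaleR_add_right)
qed

lemma subset_V: "C \<subseteq> V"
  using proper openin_imp_subset by (auto simp: proper_open_cone_def)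

lemma closure_subset_V: "closure C \<subseteq> V"
  using subset_V subspace_V by (simp add: closed_subspace closure_minimal)

lemma closure_add:
  assumes "x \<in> closure C" "y \<in> closure C" shows "x + y \<in> closure C"
proof -
  obtain f g where "\<And>n. f n \<in> C" "f \<longlonglongrightarrow> x" "\<And>n. g n \<in> C" "g \<longlonglongrightarrow> y"
    using assms unfolding closure_sequential by blast
  then show ?thesis
    unfolding closure_sequential by (intro exI[of _ "\<lambda>n. f n + g n"]) (auto intro: add tendsto_add)
qed

lemma zero_in_closure: "0 \<in> closure C"
proof -
  obtain x where "x \<in> C" using nonempty by blast
  then have "\<And>n. inverse (real (Suc n)) *\<^sub>R x \<in> C" by (intro scale) auto
  moreover have "(\<lambda>n. inverse (real (Suc n)) *\<^sub>R x) \<longlonglongrightarrow> 0 *\<^sub>R x"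
    by (intro tendsto_intros LIMSEQ_inverse_real_of_nat)
  ultimately show ?thesis
    unfolding closure_sequential
    by (intro exI[of _ "\<lambda>n. inverse (real (Suc n)) *\<^sub>R x"]) simp
qed

lemma closure_scale:
  assumes "x \<in> closure C" "c \<ge> 0" shows "c *\<^sub>R x \<in> closure C"
proof (cases "c = 0")
  case True then show ?thesis using zero_in_closure by simp
next
  case False
  obtain f where "\<And>n. f n \<in> C" "f \<longlonglongrightarrow> x"
    using assms unfolding closure_sequential by blast
  then show ?thesis unfolding closure_sequential using assms False
    by (intro exI[of _ "\<lambda>n. c *\<^sub>R f n"]) (auto intro: scale tendsto_intros)
qed

lemma closure_scale_iff: "c > 0 \<Longrightarrow> c *\<^sub>R x \<in> closure C \<longleftrightarrow> x \<in> closure C"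
  using closure_scale[of x c] closure_scale[of "c *\<^sub>R x" "inverse c"] by auto

lemma closure_limit:
  assumes "\<And>e. e > 0 \<Longrightarrow> k + e *\<^sub>R c \<in> closure C" shows "k \<in> closure C"
proof -
  have "(\<lambda>n. k + inverse (real (Suc n)) *\<^sub>R c) \<longlonglongrightarrow> k + 0 *\<^sub>R c"
    by (intro tendsto_intros LIMSEQ_inverse_real_of_nat)
  then show ?thesis
    using closed_sequentially[OF closed_closure, of "\<lambda>n. k + inverse (real (Suc n)) *\<^sub>R c" C] assms
    by simp
qed

lemma closure_antisym:
  assumes "y - x \<in> closure C" "x - y \<in> closure C" shows "x = y"
proof -
  have "y - x \<in> closure C \<inter> uminus ` closure C"
    using assms by (auto intro!: image_eqI[of _ _ "x - y"])
  moreover have "closure C \<inter> uminus ` closure C = {0}"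
    using proper by (simp add: proper_open_cone_def)
  ultimately show ?thesis by simp
qed

lemma open_at:
  assumes "x \<in> C"
  obtains e where "e > 0" "\<And>y. y \<in> V \<Longrightarrow> dist y x < e \<Longrightarrow> y \<in> C"
  using assms proper unfolding proper_open_cone_def openin_euclidean_subtopology_iff by blast

text \<open>Openness of \<open>C\<close> in \<open>V\<close> leaves room: \<open>k\<close> is
  replaced by a nearby \<open>k'\<close> in \<open>C\<close>, and the error \<open>k - k'\<close> is
  absorbed by \<open>x\<close>.\<close>

lemma add_closure:
  assumes "x \<in> C" "k \<in> closure C" shows "x + k \<in> C"
proof -
  obtain e where e: "e > 0" "\<And>y. y \<in> V \<Longrightarrow> dist y x < e \<Longrightarrow> y \<in> C"
    using open_at[OF assms(1)] by metis
  obtain k' where k': "k' \<in> C" "dist k' k < e"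
    using assms(2) e(1) closure_approachable by blast
  have "x + k - k' \<in> V"
    using assms k' subset_V closure_subset_V subspace_V by (blast intro: subspace_add subspace_diff)
  moreover have "dist (x + k - k') x < e" using k'(2) by (simp add: dist_norm norm_minus_commute)
  ultimately have "x + k - k' \<in> C" using e(2) by blast
  from add[OF this k'(1)] show ?thesis by simp
qed

text \<open>For large \<open>l\<close> the point \<open>y - w / l\<close> is so close to
  \<open>y\<close> that openness puts it into \<open>C\<close>: every point of \<open>C\<close> is
  an order unit of \<open>V\<close>.\<close>

lemma absorb:
  assumes "y \<in> C" "w \<in> V"
  obtains K where "K > 0" "\<And>l. l \<ge> K \<Longrightarrow> l *\<^sub>R y - w \<in> C"
proof -
  obtain e where e: "e > 0" "\<And>z. z \<in> V \<Longrightarrow> dist z y < e \<Longrightarrow> z \<in> C"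
    using open_at[OF assms(1)] by metis
  define K where "K = (norm w + 1) / e"
  have K: "K > 0" unfolding K_def using e by (simp add: add_nonneg_pos)
  have "l *\<^sub>R y - w \<in> C" if "l \<ge> K" for l
  proof -
    have l: "l > 0" using K that by simp
    have "norm w < l * e" using that e by (simp add: K_def divide_le_eq)
    then have "dist (y - inverse l *\<^sub>R w) y < e"
      using l by (simp add: dist_norm field_simps)
    moreover have "y - inverse l *\<^sub>R w \<in> V"
      using assms subset_V subspace_V by (blast intro: subspace_diff subspace_scale)
    ultimately have "y - inverse l *\<^sub>R w \<in> C" using e by blast
    from scale[OF this l] show ?thesis using l by (simp add: scaleR_diff_right)
  qed
  with K show thesis using that by blast
qed

lemma subset_closure: "x \<in> C \<Longrightarrow> x \<in> closure C"
  using closure_subset by blast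

lemma le_mono:
  assumes "l *\<^sub>R y - x \<in> closure C" "y \<in> closure C" "l \<le> m" shows "m *\<^sub>R y - x \<in> closure C"
proof -
  have "(l *\<^sub>R y - x) + (m - l) *\<^sub>R y \<in> closure C"
    using assms by (intro closure_add closure_scale) auto
  then show ?thesis by (simp add: algebra_simps)
qed

section \<open>Gauge and metric in terms of the order\<close>

lemma gauge_nonneg:
  assumes "x \<in> C" "y \<in> C" shows "0 \<le> gauge_M C x y"
proof -
  obtain K where "K > 0" "\<And>l. l \<ge> K \<Longrightarrow> l *\<^sub>R y - x \<in> C"
    using absorb assms subset_V by blast
  then show ?thesis unfolding gauge_M_def cone_le_def
    by (intro cInf_greatest) (auto intro!: exI[of _ K] subset_closure)
qed

text \<open>Enlarging an admissible factor keeps it admissible, and since \<open>closure C\<close>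
  is closed the relation still holds at the infimum. Passing through \<open>l + e\<close> also
  covers \<open>l = 0\<close>, which the defining set excludes.\<close>

lemma gauge_le_iff:
  assumes "x \<in> C" "y \<in> C" "l \<ge> 0"
  shows "gauge_M C x y \<le> l \<longleftrightarrow> l *\<^sub>R y - x \<in> closure C"
proof
  let ?S = "{m. m > 0 \<and> cone_le C x (m *\<^sub>R y)}"
  obtain K where "K > 0" "\<And>m. m \<ge> K \<Longrightarrow> m *\<^sub>R y - x \<in> C"
    using absorb assms subset_V by blast
  then have ne: "?S \<noteq> {}" by (auto simp: cone_le_def intro!: exI[of _ K] subset_closure)
  have bdd: "bdd_below ?S" by (intro bdd_belowI[of _ 0]) auto
  show "l *\<^sub>R y - x \<in> closure C" if "gauge_M C x y \<le> l"
  proof (rule closure_limit[where c = y])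
    fix e :: real assume "e > 0"
    then have "Inf ?S < l + e" using that by (simp add: gauge_M_def)
    then obtain m where "m \<in> ?S" "m < l + e" using cInf_lessD[OF ne] by metis
    then have "(l + e) *\<^sub>R y - x \<in> closure C"
      using le_mono[of m y x "l + e"] assms subset_closure by (simp add: cone_le_def)
    then show "l *\<^sub>R y - x + e *\<^sub>R y \<in> closure C" by (simp add: algebra_simps)
  qed
  show "gauge_M C x y \<le> l" if "l *\<^sub>R y - x \<in> closure C"
  proof (rule field_le_epsilon)
    fix e :: real assume "e > 0"
    then have "(l + e) *\<^sub>R y - x \<in> closure C"
      using le_mono[OF that, of "l + e"] assms subset_closure by simp
    then show "gauge_M C x y \<le> l + e" unfolding gauge_M_def
      using \<open>e > 0\<close> assms by (intro cInf_lower bdd) (auto simp: cone_le_def)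
  qed
qed

lemma thompson_le_iff:
  assumes "x \<in> C" "y \<in> C" "l \<ge> 1"
  shows "thompson_dist C x y \<le> ln l \<longleftrightarrow> l *\<^sub>R y - x \<in> closure C \<and> l *\<^sub>R x - y \<in> closure C"
proof -
  let ?D = "max (gauge_M C x y) (gauge_M C y x)"
  have iff: "?D \<le> m \<longleftrightarrow> m *\<^sub>R y - x \<in> closure C \<and> m *\<^sub>R x - y \<in> closure C" if "m \<ge> 0" for m
    using gauge_le_iff assms that by simp
  have "?D \<ge> 0" using gauge_nonneg assms by (simp add: le_max_iff_disj)
  then consider "?D = 0" | "?D > 0" by linarith
  then show ?thesis
  proof cases
    \<comment> \<open>The default \<open>ln 0 = 0\<close> matters here: the distance is 0, which is
      at most \<open>ln l\<close> because \<open>l \<ge> 1\<close>, and both order relations hold as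
      well.\<close>
    case 1
    then show ?thesis using iff[of l] assms by (simp add: thompson_dist_def)
  next
    case 2
    then show ?thesis using iff[of l] assms by (simp add: thompson_dist_def)
  qed
qed

end

lemma gauge_M_cong:
  assumes "\<And>l. l > 0 \<Longrightarrow> l *\<^sub>R y - x \<in> closure C \<longleftrightarrow> l *\<^sub>R y' - x' \<in> closure C'"
  shows "gauge_M C x y = gauge_M C' x' y'"
  unfolding gauge_M_def cone_le_def using assms by (intro arg_cong[of _ _ Inf]) auto

section \<open>Direct products\<close>

lemma independent_unique:
  assumes "subspace A" "subspace B" "A \<inter> B = {0}"
    and "a \<in> A" "a' \<in> A" "b \<in> B" "b' \<in> B" "a + b = a' + b'"
  shows "a = a' \<and> b = b'"
proof -
  have "a - a' = b' - b" using assms(8) by (simp add: algebra_simps)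
  moreover have "a - a' \<in> A" "b' - b \<in> B"
    by (rule subspace_diff; use assms in simp)+
  ultimately have "a - a' \<in> A \<inter> B" by simp
  then have "a - a' = 0" unfolding assms(3) by simp
  then show ?thesis using assms(8) by simp
qed

locale cone_product = open_cone +
  fixes C1 C2
  assumes product: "direct_product C C1 C2"
begin

lemma sum_eq: "C = C1 + C2" and spans: "span C1 \<inter> span C2 = {0}"
  and cone1: "pos_convex_cone C1" and cone2: "pos_convex_cone C2"
  using product by (auto simp: direct_product_def)

text \<open>Interpreting the locale again with the factors exchanged makes every fact about the
  first factor available for the second.\<close>

lemma swap: "cone_product V C C2 C1"
  using product subspace_V proper
  by unfold_locales (auto simp: direct_product_def add.commute Int_commute)

lemma unique:
  assumes "a \<in> span C1" "b \<in> span C2" "a' \<in> span C1" "b' \<in> span C2" "a + b = a' + b'"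
  shows "a = a'" "b = b'"
  using independent_unique[OF subspace_span subspace_span spans] assms by blast+

lemma sum_in: "a \<in> C1 \<Longrightarrow> b \<in> C2 \<Longrightarrow> a + b \<in> C"
  using sum_eq by (simp add: set_plus_intro)

lemma component:
  assumes "a \<in> span C1" "b \<in> span C2" "a + b \<in> C" shows "a \<in> C1"
proof -
  obtain a' b' where "a' \<in> C1" "b' \<in> C2" "a + b = a' + b'"
    using assms(3) sum_eq by (auto elim: set_plus_elim)
  then show ?thesis using unique[of a b a' b'] assms span_base by metis
qed

text \<open>\<open>C1\<close> need not lie in \<open>C\<close>, but each \<open>a\<close> in
  \<open>C1\<close> is the difference of \<open>2 a + b\<close> and \<open>a + b\<close>, which
  do.\<close>

lemma span_subset_V: "span C1 \<subseteq> V"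
proof -
  obtain b where b: "b \<in> C2" using cone2 by (auto simp: pos_convex_cone_def)
  have "a \<in> V" if a: "a \<in> C1" for a
  proof -
    have "2 *\<^sub>R a \<in> C1" using cone1 a by (simp add: pos_convex_cone_def)
    then have "2 *\<^sub>R a + b - (a + b) \<in> V"
      using a b sum_in subset_V subspace_V by (blast intro: subspace_diff)
    then show ?thesis by (simp add: scaleR_2)
  qed
  then show ?thesis using subspace_V by (simp add: span_minimal subsetI)
qed

text \<open>Adding \<open>e\<close> times a point \<open>a' + b'\<close> of \<open>C\<close> pushes
  \<open>a + b\<close> from the closure into \<open>C\<close>, where \<open>component\<close>
  applies; then \<open>e\<close> tends to 0.\<close>

lemma closure_component:
  assumes "a \<in> span C1" "b \<in> span C2" "a + b \<in> closure C" shows "a \<in> closure C1"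
proof -
  obtain a' b' where c: "a' \<in> C1" "b' \<in> C2" using cone1 cone2 by (auto simp: pos_convex_cone_def)
  have C1: "a + e *\<^sub>R a' \<in> C1" if "e > 0" for e
  proof (rule component)
    have "e *\<^sub>R (a' + b') + (a + b) \<in> C"
      using that c assms by (intro add_closure scale sum_in)
    then show "a + e *\<^sub>R a' + (b + e *\<^sub>R b') \<in> C" by (simp add: algebra_simps)
  qed (use assms c in \<open>auto intro: span_add span_scale span_base\<close>)
  have "(\<lambda>n. a + inverse (real (Suc n)) *\<^sub>R a') \<longlonglongrightarrow> a + 0 *\<^sub>R a'"
    by (intro tendsto_intros LIMSEQ_inverse_real_of_nat)
  then show ?thesis unfolding closure_sequential using C1
    by (intro exI[of _ "\<lambda>n. a + inverse (real (Suc n)) *\<^sub>R a'"]) auto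
qed

lemma factor_subset_closure: "closure C1 \<subseteq> closure C"
proof (rule closure_minimal)
  show "C1 \<subseteq> closure C"
  proof
    fix a assume a: "a \<in> C1"
    obtain b where b: "b \<in> C2" using cone2 by (auto simp: pos_convex_cone_def)
    show "a \<in> closure C"
    proof (rule closure_limit)
      fix e :: real assume "e > 0"
      then show "a + e *\<^sub>R b \<in> closure C"
        using a b cone2 by (intro subset_closure sum_in) (auto simp: pos_convex_cone_def)
    qed
  qed
qed simp

text \<open>The order of a factor is the restriction of the order of \<open>C\<close>, so gauges of
  factors can be computed in the whole cone.\<close>

lemma closure_factor_iff: "a \<in> span C1 \<Longrightarrow> a \<in> closure C1 \<longleftrightarrow> a \<in> closure C"
  using closure_component[of a 0] factor_subset_closure by (auto simp: span_zero)

lemma zero_in_closure_factor: "0 \<in> closure C1"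
  using closure_factor_iff zero_in_closure span_zero by blast

text \<open>For fixed \<open>b\<close> in \<open>C2\<close>, a point \<open>a\<close> of
  \<open>span C1\<close> is in \<open>C1\<close> iff \<open>a + b\<close> is in \<open>C\<close>; so
  \<open>C1\<close> is a translated slice of a relatively open set. Pointedness is inherited from
  \<open>closure C\<close>.\<close>

lemma factor_proper: "proper_open_cone (span C1) C1"
  unfolding proper_open_cone_def
proof (intro conjI cone1)
  obtain b where b: "b \<in> C2" using cone2 by (auto simp: pos_convex_cone_def)
  obtain T where T: "open T" "C = V \<inter> T"
    using proper unfolding proper_open_cone_def openin_open by blast
  interpret S: cone_product V C C2 C1 by (rule swap)
  have "C1 = span C1 \<inter> (\<lambda>a. a + b) -` T"
  proof (intro equalityI subsetI)
    fix a assume "a \<in> C1"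
    then show "a \<in> span C1 \<inter> (\<lambda>a. a + b) -` T" using b sum_in T span_base by auto
  next
    fix a assume a: "a \<in> span C1 \<inter> (\<lambda>a. a + b) -` T"
    then have "a + b \<in> V"
      using span_subset_V S.span_subset_V b subspace_V span_base by (blast intro: subspace_add)
    then have "a + b \<in> C" using a T by auto
    then show "a \<in> C1" using component a b span_base by blast
  qed
  moreover have "open ((\<lambda>a. a + b) -` T)"
    by (intro open_vimage T continuous_intros)
  ultimately show "openin (top_of_set (span C1)) C1" unfolding openin_open by blast
  show "closure C1 \<inter> uminus ` closure C1 = {0}"
  proof -
    have "closure C \<inter> uminus ` closure C = {0}" using proper by (simp add: proper_open_cone_def)
    moreover have "0 \<in> uminus ` closure C1" using zero_in_closure_factor by (auto simp: image_iff)
    ultimately show ?thesis using factor_subset_closure zero_in_closure_factor by blast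
  qed
qed

lemma factor_absorb:
  assumes "a \<in> C1" "a' \<in> C1"
  obtains K where "K > 0" "\<And>l. l \<ge> K \<Longrightarrow> l *\<^sub>R a - a' \<in> closure C"
proof -
  interpret F: open_cone "span C1" C1 by unfold_locales (auto simp: factor_proper)
  from F.absorb[OF assms(1), of a'] assms(2) obtain K
    where "K > 0" "\<And>l. l \<ge> K \<Longrightarrow> l *\<^sub>R a - a' \<in> C1" using span_base by blast
  then show thesis using that F.subset_closure factor_subset_closure by blast
qed

text \<open>The order of \<open>C\<close> is the product order; this later splits a relation into
  one for each component.\<close>

lemma closure_sum_iff:
  assumes "a \<in> span C1" "b \<in> span C2"
  shows "a + b \<in> closure C \<longleftrightarrow> a \<in> closure C \<and> b \<in> closure C"
proof -
  interpret S: cone_product V C C2 C1 by (rule swap)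
  show ?thesis
    using closure_component[OF assms] S.closure_component[OF assms(2,1)] closure_add
      factor_subset_closure S.factor_subset_closure by (auto simp: add.commute)
qed

end

section \<open>Thompson isometries\<close>

locale isometry = dom: open_cone V C + cod: open_cone V' C'
  for V C :: "'a::euclidean_space set" and V' C' :: "'b::euclidean_space set" +
  fixes \<phi> :: "'a \<Rightarrow> 'b"
  assumes iso: "thompson_isometry C C' \<phi>" and surj: "\<phi> ` C = C'"
begin

lemma image_in: "x \<in> C \<Longrightarrow> \<phi> x \<in> C'"
  using surj by blast

text \<open>Equality of distances transfers the two order relations only as a pair; separating them
  is the task of the final argument.\<close>

lemma close_iff:
  assumes "x \<in> C" "y \<in> C" "l \<ge> 1"
  shows "l *\<^sub>R \<phi> y - \<phi> x \<in> closure C' \<and> l *\<^sub>R \<phi> x - \<phi> y \<in> closure C' \<longleftrightarrow>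
    l *\<^sub>R y - x \<in> closure C \<and> l *\<^sub>R x - y \<in> closure C"
  using assms iso dom.thompson_le_iff cod.thompson_le_iff image_in
  unfolding thompson_isometry_def by metis

lemma inj: "inj_on \<phi> C"
proof (rule inj_onI)
  fix x y assume "x \<in> C" "y \<in> C" "\<phi> x = \<phi> y"
  then show "x = y"
    using close_iff[of x y 1] cod.zero_in_closure dom.closure_antisym[of y x] by simp
qed

lemma inverse_isometry: "isometry V' C' V C (inv_into C \<phi>)"
proof
  show "inv_into C \<phi> ` C' = C" using surj inj inv_into_image_cancel by blast
  have in_C: "inv_into C \<phi> y \<in> C" if "y \<in> C'" for y
    using that surj by (simp add: inv_into_into)
  have cancel: "\<phi> (inv_into C \<phi> y) = y" if "y \<in> C'" for y
    using that surj by (simp add: f_inv_into_f)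
  show "thompson_isometry C' C (inv_into C \<phi>)"
    unfolding thompson_isometry_def
  proof (intro conjI ballI Pi_I)
    fix x y assume xy: "x \<in> C'" "y \<in> C'"
    have "thompson_dist C' (\<phi> (inv_into C \<phi> x)) (\<phi> (inv_into C \<phi> y)) =
        thompson_dist C (inv_into C \<phi> x) (inv_into C \<phi> y)"
      using iso in_C[OF xy(1)] in_C[OF xy(2)] by (simp add: thompson_isometry_def)
    then show "thompson_dist C (inv_into C \<phi> x) (inv_into C \<phi> y) = thompson_dist C' x y"
      using cancel xy by simp
  qed (rule in_C)
qed

section \<open>Isometries along rays\<close>

text \<open>The hypotheses bound the distance of \<open>z\<close> to \<open>\<phi> (c x)\<close> by
  \<open>ln (c/b)\<close> and to \<open>\<phi> (a x)\<close> by \<open>ln (b/a)\<close>. For the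
  preimage \<open>y\<close> of \<open>z\<close>, one relation from each pair shows that
  \<open>y\<close> is above and below \<open>b x\<close>.\<close>

lemma between_unique:
  assumes x: "x \<in> C" and z: "z \<in> C'" and abc: "0 < a" "a \<le> b" "b \<le> c"
    and "(c/b) *\<^sub>R z - \<phi> (c *\<^sub>R x) \<in> closure C'" "(c/b) *\<^sub>R \<phi> (c *\<^sub>R x) - z \<in> closure C'"
    and "(b/a) *\<^sub>R z - \<phi> (a *\<^sub>R x) \<in> closure C'" "(b/a) *\<^sub>R \<phi> (a *\<^sub>R x) - z \<in> closure C'"
  shows "z = \<phi> (b *\<^sub>R x)"
proof -
  obtain y where y: "y \<in> C" "z = \<phi> y" using z surj by blast
  have c: "(c/b) *\<^sub>R y - c *\<^sub>R x \<in> closure C" and a: "(b/a) *\<^sub>R (a *\<^sub>R x) - y \<in> closure C"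
    using close_iff[of "c *\<^sub>R x" y "c/b"] close_iff[of "a *\<^sub>R x" y "b/a"] assms y dom.scale by auto
  have "(b/c) *\<^sub>R ((c/b) *\<^sub>R y - c *\<^sub>R x) \<in> closure C"
    using c abc by (intro dom.closure_scale) auto
  then have "y - b *\<^sub>R x \<in> closure C" using abc by (simp add: scaleR_diff_right)
  moreover have "b *\<^sub>R x - y \<in> closure C" using a abc by simp
  ultimately show ?thesis using y dom.closure_antisym by blast
qed

lemma interpolate:
  assumes x: "x \<in> C" and abc: "0 < a" "a < b" "b < c"
  shows "(c/a - a/c) *\<^sub>R \<phi> (b *\<^sub>R x) = (b/a - a/b) *\<^sub>R \<phi> (c *\<^sub>R x) + (c/b - b/c) *\<^sub>R \<phi> (a *\<^sub>R x)"
proof -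
  have pos: "q/p - p/q > 0" if "0 < p" "p < q" for p q :: real
  proof -
    have "p/q < 1" "1 < q/p" using that by auto
    then show ?thesis by linarith
  qed
  \<comment> \<open>\<open>\<alpha>\<close> and \<open>\<beta>\<close> solve
    \<open>\<alpha> c + \<beta> a = b\<close> and \<open>\<alpha> / c + \<beta> / a = 1 / b\<close>,
    as they must for a function of the form \<open>l u + v / l\<close>.\<close>
  define D where "D = c/a - a/c"
  define \<alpha> where "\<alpha> = (b/a - a/b) / D"
  define \<beta> where "\<beta> = (c/b - b/c) / D"
  have D: "D > 0" and \<alpha>: "\<alpha> > 0" and \<beta>: "\<beta> > 0"
    using pos[of a c] pos[of a b] pos[of b c] abc by (auto simp: D_def \<alpha>_def \<beta>_def)
  let ?p = "\<phi> (c *\<^sub>R x)" and ?q = "\<phi> (a *\<^sub>R x)"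
  let ?z = "\<alpha> *\<^sub>R ?p + \<beta> *\<^sub>R ?q"
  have pC: "?p \<in> C'" and qC: "?q \<in> C'" using abc x by (auto intro!: image_in dom.scale)
  have z: "?z \<in> C'" using pC qC \<alpha> \<beta> by (intro cod.add cod.scale)
  have "(c/a) *\<^sub>R (a *\<^sub>R x) - c *\<^sub>R x = 0" "(c/a) *\<^sub>R (c *\<^sub>R x) - a *\<^sub>R x = (c*c/a - a) *\<^sub>R x"
    using abc by (auto simp: algebra_simps)
  moreover have "a * a \<le> c * c" using abc by (intro mult_mono) auto
  then have "(c*c/a - a) *\<^sub>R x \<in> closure C"
    using abc by (intro dom.closure_scale dom.subset_closure x) (simp add: le_divide_eq)
  ultimately have pq: "(c/a) *\<^sub>R ?q - ?p \<in> closure C'" and qp: "(c/a) *\<^sub>R ?p - ?q \<in> closure C'"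
    using close_iff[of "c *\<^sub>R x" "a *\<^sub>R x" "c/a"] abc x dom.scale dom.zero_in_closure by auto
  have sums: "\<alpha> * c + \<beta> * a = b" "\<alpha> / c + \<beta> / a = 1 / b"
  proof -
    have "(b/a - a/b) * c + (c/b - b/c) * a = b * D" "(b/a - a/b) / c + (c/b - b/c) / a = D / b"
      using abc by (simp_all add: D_def field_simps)
    moreover have "\<alpha> * c + \<beta> * a = ((b/a - a/b) * c + (c/b - b/c) * a) / D"
      "\<alpha> / c + \<beta> / a = ((b/a - a/b) / c + (c/b - b/c) / a) / D"
      by (simp_all add: \<alpha>_def \<beta>_def add_divide_distrib mult.commute)
    ultimately show "\<alpha> * c + \<beta> * a = b" "\<alpha> / c + \<beta> / a = 1 / b" using D by simp_all
  qed
  \<comment> \<open>With these, each difference required by \<open>between_unique\<close> is a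
    positive multiple of \<open>(c/a) ?q - ?p\<close> or \<open>(c/a) ?p - ?q\<close>.\<close>
  have coeff: "c/b - \<alpha> = \<beta> * (c/a)" "b/a - \<beta> = \<alpha> * (c/a)"
      "(c/b) * \<alpha> - 1 = - (\<beta> * a / b)" "(b/a) * \<beta> - 1 = - (b * \<alpha> / c)"
  proof -
    have "c * (\<alpha> / c + \<beta> / a) = c / b" "b * (\<alpha> / c + \<beta> / a) = 1" using sums abc by simp_all
    then show "c/b - \<alpha> = \<beta> * (c/a)" "(b/a) * \<beta> - 1 = - (b * \<alpha> / c)"
      using abc by (simp_all add: algebra_simps)
    have "(\<alpha> * c + \<beta> * a) / a = b / a" "(\<alpha> * c + \<beta> * a) / b = 1" using sums abc by simp_all
    then show "b/a - \<beta> = \<alpha> * (c/a)" "(c/b) * \<alpha> - 1 = - (\<beta> * a / b)"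
      using abc by (simp_all add: add_divide_distrib algebra_simps)
  qed
  have "?z = \<phi> (b *\<^sub>R x)"
  proof (rule between_unique[OF x z])
    have "(c/b) *\<^sub>R ?z - ?p = ((c/b) * \<alpha> - 1) *\<^sub>R ?p + ((c/b) * \<beta>) *\<^sub>R ?q"
      by (simp add: algebra_simps)
    also have "\<dots> = (\<beta> * a / b) *\<^sub>R ((c/a) *\<^sub>R ?q - ?p)"
      unfolding coeff using abc by (simp add: algebra_simps)
    also have "\<dots> \<in> closure C'" using pq \<beta> abc by (intro cod.closure_scale) auto
    finally show "(c/b) *\<^sub>R ?z - ?p \<in> closure C'" .
    have "(b/a) *\<^sub>R ?z - ?q = ((b/a) * \<alpha>) *\<^sub>R ?p + ((b/a) * \<beta> - 1) *\<^sub>R ?q"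
      by (simp add: algebra_simps)
    also have "\<dots> = (b * \<alpha> / c) *\<^sub>R ((c/a) *\<^sub>R ?p - ?q)"
      unfolding coeff using abc by (simp add: algebra_simps)
    also have "\<dots> \<in> closure C'" using qp \<alpha> abc by (intro cod.closure_scale) auto
    finally show "(b/a) *\<^sub>R ?z - ?q \<in> closure C'" .
    have "(c/b) *\<^sub>R ?p - ?z = (c/b - \<alpha>) *\<^sub>R ?p - \<beta> *\<^sub>R ?q" by (simp add: algebra_simps)
    also have "\<dots> = \<beta> *\<^sub>R ((c/a) *\<^sub>R ?p - ?q)" unfolding coeff by (simp add: algebra_simps)
    also have "\<dots> \<in> closure C'" using qp \<beta> by (intro cod.closure_scale) auto
    finally show "(c/b) *\<^sub>R ?p - ?z \<in> closure C'" .
    have "(b/a) *\<^sub>R ?q - ?z = (b/a - \<beta>) *\<^sub>R ?q - \<alpha> *\<^sub>R ?p" by (simp add: algebra_simps)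
    also have "\<dots> = \<alpha> *\<^sub>R ((c/a) *\<^sub>R ?q - ?p)" unfolding coeff by (simp add: algebra_simps)
    also have "\<dots> \<in> closure C'" using pq \<alpha> by (intro cod.closure_scale) auto
    finally show "(b/a) *\<^sub>R ?q - ?z \<in> closure C'" .
  qed (use abc in auto)
  then have "D *\<^sub>R \<phi> (b *\<^sub>R x) = (D * \<alpha>) *\<^sub>R ?p + (D * \<beta>) *\<^sub>R ?q"
    by (metis scaleR_add_right scaleR_scaleR)
  moreover have "D * \<alpha> = b/a - a/b" "D * \<beta> = c/b - b/c" using D by (simp_all add: \<alpha>_def \<beta>_def)
  ultimately show ?thesis by (simp add: D_def)
qed

text \<open>The coefficients solve \<open>\<phi> x = u + v\<close> and \<open>\<phi> (2 x) = 2 u + v / 2\<close>.\<close>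

definition u where "u x = (1/3) *\<^sub>R (2 *\<^sub>R \<phi> (2 *\<^sub>R x) - \<phi> x)"
definition v where "v x = (1/3) *\<^sub>R (4 *\<^sub>R \<phi> x - 2 *\<^sub>R \<phi> (2 *\<^sub>R x))"

lemma ray:
  assumes x: "x \<in> C" and l: "l > 0"
  shows "\<phi> (l *\<^sub>R x) = l *\<^sub>R u x + inverse l *\<^sub>R v x"
proof -
  let ?w = "l *\<^sub>R u x + inverse l *\<^sub>R v x"
  let ?f = "\<phi> (l *\<^sub>R x)" and ?p = "\<phi> x" and ?q = "\<phi> (2 *\<^sub>R x)"
  have w: "?w = ((2/3) * (l - 1/l)) *\<^sub>R ?q + ((2/3) * (2/l - l/2)) *\<^sub>R ?p"
  proof -
    have "(2/3) * (l - 1/l) = l * ((1/3) * 2) - inverse l * ((1/3) * 2)"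
      "(2/3) * (2/l - l/2) = inverse l * ((1/3) * 4) - l * (1/3)"
      using l by (simp_all add: field_simps)
    then show ?thesis
      by (simp only: u_def v_def scaleR_diff_left scaleR_diff_right scaleR_scaleR)
        (simp only: algebra_simps)
  qed
  \<comment> \<open>\<open>interpolate\<close> is applied to \<open>l\<close>, 1 and 2 in increasing
    order, so \<open>l\<close> is its smallest, middle or largest parameter. The factor
    \<open>3/2\<close> is \<open>c/a - a/c\<close> for \<open>a = 1\<close> and
    \<open>c = 2\<close>.\<close>
  have 3: "(3/2) *\<^sub>R ?f = (l - 1/l) *\<^sub>R ?q + (2/l - l/2) *\<^sub>R ?p"
  proof -
    consider "l < 1" | "l = 1" | "1 < l" "l < 2" | "l = 2" | "2 < l" by linarith
    then show ?thesis
    proof cases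
      case 1
      from interpolate[OF x l 1, of 2] show ?thesis by (simp add: algebra_simps)
    next
      case 3
      from interpolate[OF x _ 3] show ?thesis by simp
    next
      case 5
      from interpolate[OF x _ _ 5, of 1] show ?thesis by (simp add: algebra_simps)
    qed simp_all
  qed
  have "?f = (2/3) *\<^sub>R ((3/2) *\<^sub>R ?f)" by simp
  also have "\<dots> = ((2/3) * (l - 1/l)) *\<^sub>R ?q + ((2/3) * (2/l - l/2)) *\<^sub>R ?p"
    unfolding 3 by (simp only: scaleR_add_right scaleR_scaleR)
  finally show ?thesis using w by simp
qed

lemma sum_uv: "x \<in> C \<Longrightarrow> \<phi> x = u x + v x"
  using ray[of x 1] by simp

text \<open>Divide by \<open>l\<close> and let \<open>l\<close> tend to infinity for \<open>u\<close>; multiply by \<open>l\<close> and let \<open>l\<close> tend to 0 for \<open>v\<close>.\<close>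

lemma u_v_limits:
  assumes "x \<in> C" "y \<in> C"
    and "\<And>l. l > 0 \<Longrightarrow> k *\<^sub>R \<phi> (l *\<^sub>R y) - m *\<^sub>R \<phi> (l *\<^sub>R x) \<in> closure C'"
  shows "k *\<^sub>R u y - m *\<^sub>R u x \<in> closure C'" "k *\<^sub>R v y - m *\<^sub>R v x \<in> closure C'"
proof -
  let ?a = "k *\<^sub>R u y - m *\<^sub>R u x" and ?b = "k *\<^sub>R v y - m *\<^sub>R v x"
  have *: "l *\<^sub>R ?a + inverse l *\<^sub>R ?b \<in> closure C'" if "l > 0" for l
  proof -
    have "l *\<^sub>R ?a + inverse l *\<^sub>R ?b = k *\<^sub>R \<phi> (l *\<^sub>R y) - m *\<^sub>R \<phi> (l *\<^sub>R x)"
      using ray assms(1,2) that by (simp add: algebra_simps)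
    then show ?thesis using assms(3) that by simp
  qed
  show "?a \<in> closure C'"
  proof (rule cod.closure_limit)
    fix e :: real assume e: "e > 0"
    \<comment> \<open>With \<open>l = 1 / sqrt e\<close>, multiplication by \<open>sqrt e\<close>
      leaves coefficient 1 at \<open>?a\<close> and \<open>e\<close> at \<open>?b\<close>.\<close>
    have "sqrt e *\<^sub>R (inverse (sqrt e) *\<^sub>R ?a + inverse (inverse (sqrt e)) *\<^sub>R ?b) \<in> closure C'"
      using e by (intro cod.closure_scale *) auto
    then show "?a + e *\<^sub>R ?b \<in> closure C'"
      using e by (simp add: scaleR_add_right del: scaleR_diff_right)
  qed
  show "?b \<in> closure C'"
  proof (rule cod.closure_limit)
    fix e :: real assume e: "e > 0"
    have "sqrt e *\<^sub>R (sqrt e *\<^sub>R ?a + inverse (sqrt e) *\<^sub>R ?b) \<in> closure C'"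
      using e by (intro cod.closure_scale *) auto
    then show "?b + e *\<^sub>R ?a \<in> closure C'"
      using e by (simp add: scaleR_add_right add.commute del: scaleR_diff_right)
  qed
qed

section \<open>Order properties of the two components\<close>

lemma
  assumes x: "x \<in> C"
  shows u_in: "u x \<in> closure C'" and v_in: "v x \<in> closure C'"
proof -
  have "1 *\<^sub>R \<phi> (l *\<^sub>R x) - 0 *\<^sub>R \<phi> (l *\<^sub>R x) \<in> closure C'" if "l > 0" for l
    using x that by (simp add: cod.subset_closure image_in dom.scale)
  from u_v_limits[OF x x this] show "u x \<in> closure C'" "v x \<in> closure C'" by simp_all
qed

text \<open>A large \<open>K\<close> gives both relations between \<open>x\<close> and
  \<open>y\<close>, hence between \<open>l x\<close> and \<open>l y\<close> for every
  \<open>l\<close>. The isometry keeps this \<open>K\<close>, and the limits separate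
  \<open>u\<close> from \<open>v\<close>.\<close>

lemma comparable:
  assumes "x \<in> C" "y \<in> C"
  obtains K where "K \<ge> 1" "K *\<^sub>R u y - u x \<in> closure C'" "K *\<^sub>R v y - v x \<in> closure C'"
proof -
  obtain K1 K2 where K1: "\<And>l. l \<ge> K1 \<Longrightarrow> l *\<^sub>R y - x \<in> C" and K2: "\<And>l. l \<ge> K2 \<Longrightarrow> l *\<^sub>R x - y \<in> C"
    using dom.absorb assms dom.subset_V by (metis subsetD)
  define K where "K = max 1 (max K1 K2)"
  have K: "K \<ge> 1" by (simp add: K_def)
  have "K *\<^sub>R \<phi> (l *\<^sub>R y) - 1 *\<^sub>R \<phi> (l *\<^sub>R x) \<in> closure C'" if l: "l > 0" for l
  proof -
    have "l *\<^sub>R (K *\<^sub>R y - x) \<in> closure C" "l *\<^sub>R (K *\<^sub>R x - y) \<in> closure C"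
      using l K1[of K] K2[of K] by (simp_all add: K_def dom.subset_closure dom.scale)
    then have "K *\<^sub>R (l *\<^sub>R y) - l *\<^sub>R x \<in> closure C \<and> K *\<^sub>R (l *\<^sub>R x) - l *\<^sub>R y \<in> closure C"
      by (simp add: scaleR_diff_right mult.commute)
    then show ?thesis using close_iff[of "l *\<^sub>R x" "l *\<^sub>R y" K] assms K l dom.scale by simp
  qed
  from u_v_limits[OF assms this] show thesis using that K by simp
qed

text \<open>Bounding \<open>w\<close> and \<open>- w\<close> together lets the bound survive
  negative scalars, so it passes from the generators to all linear combinations.\<close>

lemma span_bound:
  assumes "\<And>y. y \<in> A \<Longrightarrow> y \<in> closure C' \<and> (\<exists>K. K *\<^sub>R a - y \<in> closure C')"
    and a: "a \<in> closure C'" and "w \<in> span A"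
  obtains K where "K > 0" "K *\<^sub>R a - w \<in> closure C'" "K *\<^sub>R a + w \<in> closure C'"
proof -
  let ?P = "\<lambda>K w. K *\<^sub>R a - w \<in> closure C' \<and> K *\<^sub>R a + w \<in> closure C'"
  have mono: "?P L w" if "?P K w" "K \<le> L" for K L w
    using cod.le_mono[of K a w L] cod.le_mono[of K a "- w" L] that a by simp
  have "\<exists>K. ?P K w"
    using assms(3)
  proof (induction rule: span_induct_alt)
    case base
    then show ?case using cod.zero_in_closure by (auto intro!: exI[of _ 0])
  next
    case (step c y z)
    obtain K L where K: "?P K z" and L: "y \<in> closure C'" "L *\<^sub>R a - y \<in> closure C'"
      using step assms(1) by blast
    \<comment> \<open>A nonnegative factor keeps the multiple of \<open>a\<close> in the closure,
      hence also its sum with \<open>y\<close>. For negative \<open>c\<close> the two bounds below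
      exchange roles.\<close>
    have "?P (max L 0) y"
      using cod.le_mono[OF L(2) a, of "max L 0"] L a by (auto intro!: cod.closure_add cod.closure_scale)
    then have "\<bar>c\<bar> *\<^sub>R (max L 0 *\<^sub>R a - y) \<in> closure C'" "\<bar>c\<bar> *\<^sub>R (max L 0 *\<^sub>R a + y) \<in> closure C'"
      by (auto intro!: cod.closure_scale)
    then have "?P (\<bar>c\<bar> * max L 0) (c *\<^sub>R y)"
      by (cases "c \<ge> 0") (auto simp: scaleR_add_right scaleR_diff_right)
    then have "(\<bar>c\<bar> * max L 0) *\<^sub>R a - c *\<^sub>R y + (K *\<^sub>R a - z) \<in> closure C'"
      "(\<bar>c\<bar> * max L 0) *\<^sub>R a + c *\<^sub>R y + (K *\<^sub>R a + z) \<in> closure C'"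
      using K by (auto intro: cod.closure_add)
    then have "?P (\<bar>c\<bar> * max L 0 + K) (c *\<^sub>R y + z)" by (simp add: algebra_simps)
    then show ?case by blast
  qed
  then obtain K where "?P K w" by blast
  with mono[of K w "max K 1"] show thesis using that[of "max K 1"] by simp
qed

text \<open>A common vector \<open>w\<close> is dominated by multiples of both \<open>u c\<close>
  and \<open>v c\<close>. Adding a small \<open>e w\<close> to \<open>\<phi> c\<close> then respects
  the distance bounds to \<open>\<phi> (2 c)\<close> and \<open>\<phi> (c/2)\<close>, so uniqueness
  of the point between them forces \<open>w = 0\<close>.\<close>

lemma spans_disjoint: "span (u ` C) \<inter> span (v ` C) = {0}"
proof -
  have "w = 0" if w: "w \<in> span (u ` C)" "w \<in> span (v ` C)" for w
  proof -
    obtain c where c: "c \<in> C" using dom.nonempty by blast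
    have "y \<in> closure C' \<and> (\<exists>K. K *\<^sub>R u c - y \<in> closure C')" if "y \<in> u ` C" for y
      using that comparable c u_in by (metis imageE)
    from span_bound[OF this u_in[OF c] w(1)] obtain K1
      where K1: "K1 > 0" "K1 *\<^sub>R u c - w \<in> closure C'" "K1 *\<^sub>R u c + w \<in> closure C'" by blast
    have "y \<in> closure C' \<and> (\<exists>K. K *\<^sub>R v c - y \<in> closure C')" if "y \<in> v ` C" for y
      using that comparable c v_in by (metis imageE)
    from span_bound[OF this v_in[OF c] w(2)] obtain K2
      where K2: "K2 > 0" "K2 *\<^sub>R v c - w \<in> closure C'" "K2 *\<^sub>R v c + w \<in> closure C'" by blast
    define K where "K = max K1 K2"
    have bounds: "K *\<^sub>R u c - w \<in> closure C'" "K *\<^sub>R u c + w \<in> closure C'"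
        "K *\<^sub>R v c - w \<in> closure C'" "K *\<^sub>R v c + w \<in> closure C'"
      using cod.le_mono[OF K1(2) u_in[OF c], of K] cod.le_mono[of K1 "u c" "- w" K]
        cod.le_mono[OF K2(2) v_in[OF c], of K] cod.le_mono[of K2 "v c" "- w" K]
        K1 K2 u_in v_in c by (auto simp: K_def)
    have K: "K > 0" using K1 by (simp add: K_def)
    \<comment> \<open>The slack is \<open>2 \<phi> c - \<phi> (2 c) = (3/2) v c\<close>, and
      \<open>(3/2) u c\<close> for \<open>c/2\<close>. The perturbation of these differences is
      \<open>2 e w\<close>, whence the bound \<open>3/4\<close> for \<open>e w\<close>.\<close>
    define e where "e = 3 / (4 * K)"
    have e: "e > 0" "e * K = 3/4" using K by (auto simp: e_def)
    have scaled: "(3/4) *\<^sub>R u c - e *\<^sub>R w \<in> closure C'" "(3/4) *\<^sub>R u c + e *\<^sub>R w \<in> closure C'"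
        "(3/4) *\<^sub>R v c - e *\<^sub>R w \<in> closure C'" "(3/4) *\<^sub>R v c + e *\<^sub>R w \<in> closure C'"
      using bounds[THEN cod.closure_scale, of e] e by (auto simp: scaleR_diff_right scaleR_add_right)
    let ?z = "u c + v c + e *\<^sub>R w"
    have p: "\<phi> (2 *\<^sub>R c) = 2 *\<^sub>R u c + (1/2) *\<^sub>R v c" and q: "\<phi> ((1/2) *\<^sub>R c) = (1/2) *\<^sub>R u c + 2 *\<^sub>R v c"
      using ray[OF c, of 2] ray[OF c, of "1/2"] by simp_all
    have eq1: "2 *\<^sub>R ?z - \<phi> (2 *\<^sub>R c) = 2 *\<^sub>R ((3/4) *\<^sub>R v c + e *\<^sub>R w)"
      unfolding p by (simp add: algebra_simps flip: scaleR_add_left)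
    have eq2: "2 *\<^sub>R \<phi> (2 *\<^sub>R c) - ?z = ((3/4) *\<^sub>R u c - e *\<^sub>R w) + (9/4) *\<^sub>R u c"
      unfolding p using scaleR_add_left[of 1 3 "u c"] by (simp add: algebra_simps flip: scaleR_add_left)
    have eq3: "2 *\<^sub>R ?z - \<phi> ((1/2) *\<^sub>R c) = 2 *\<^sub>R ((3/4) *\<^sub>R u c + e *\<^sub>R w)"
      unfolding q by (simp add: algebra_simps flip: scaleR_add_left)
    have eq4: "2 *\<^sub>R \<phi> ((1/2) *\<^sub>R c) - ?z = ((3/4) *\<^sub>R v c - e *\<^sub>R w) + (9/4) *\<^sub>R v c"
      unfolding q using scaleR_add_left[of 1 3 "v c"] by (simp add: algebra_simps flip: scaleR_add_left)
    have le: "2 *\<^sub>R ?z - \<phi> (2 *\<^sub>R c) \<in> closure C'" "2 *\<^sub>R \<phi> (2 *\<^sub>R c) - ?z \<in> closure C'"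
        "2 *\<^sub>R ?z - \<phi> ((1/2) *\<^sub>R c) \<in> closure C'" "2 *\<^sub>R \<phi> ((1/2) *\<^sub>R c) - ?z \<in> closure C'"
      unfolding eq1 eq2 eq3 eq4 using scaled u_in[OF c] v_in[OF c]
      by (auto intro!: cod.closure_scale intro: cod.closure_add cod.closure_scale)
    have "(1/2) *\<^sub>R (\<phi> (2 *\<^sub>R c) + (2 *\<^sub>R ?z - \<phi> (2 *\<^sub>R c))) \<in> C'"
      using c le by (intro cod.scale cod.add_closure image_in dom.scale) auto
    then have z: "?z \<in> C'" by simp
    have "?z = \<phi> (1 *\<^sub>R c)"
      by (rule between_unique[OF c z, of "1/2" 1 2]) (use le in simp_all)
    then have "e *\<^sub>R w = 0" using sum_uv[OF c] by simp
    then show "w = 0" using e by simp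
  qed
  then show ?thesis using span_zero by blast
qed

section \<open>Decomposition of the target cone\<close>

text \<open>Independence of the spans identifies the components of \<open>\<phi> x\<close> from any
  splitting, without evaluating \<open>\<phi> (2 x)\<close>.\<close>

lemma uv_unique:
  assumes "a \<in> span (u ` C)" "b \<in> span (v ` C)" "x \<in> C" "\<phi> x = a + b"
  shows "a = u x" "b = v x"
proof -
  have "u x \<in> span (u ` C)" "v x \<in> span (v ` C)" using assms(3) by (auto intro: span_base)
  then show "a = u x" "b = v x"
    using independent_unique[OF subspace_span subspace_span spans_disjoint, of a "u x" b "v x"]
      assms sum_uv[OF assms(3)] by auto
qed

lemma codomain_product: "direct_product C' (u ` C) (v ` C)"
  unfolding direct_product_def
proof (intro conjI cod.convex_cone spans_disjoint)
  \<comment> \<open>This serves both convexity (\<open>s + t = 1\<close>) and scaling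
    (\<open>t = 0\<close>). By surjectivity the combination of \<open>\<phi> x\<close> and
    \<open>\<phi> y\<close> is some \<open>\<phi> w\<close>, whose components must be the combined
    ones.\<close>
  have lin: "s *\<^sub>R u x + t *\<^sub>R u y \<in> u ` C" "s *\<^sub>R v x + t *\<^sub>R v y \<in> v ` C"
    if xy: "x \<in> C" "y \<in> C" and st: "s \<ge> 0" "t \<ge> 0" "s + t > 0" for x y s t
  proof -
    have "s *\<^sub>R \<phi> x + t *\<^sub>R \<phi> y \<in> C'"
    proof (cases "s = 0")
      case True then show ?thesis using xy st by (auto intro!: cod.scale image_in)
    next
      case False
      then show ?thesis using xy st
        by (intro cod.add_closure cod.closure_scale cod.subset_closure cod.scale image_in) auto
    qed
    then obtain w where w: "w \<in> C" "\<phi> w = s *\<^sub>R \<phi> x + t *\<^sub>R \<phi> y" using surj by (metis imageE)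
    then have "\<phi> w = (s *\<^sub>R u x + t *\<^sub>R u y) + (s *\<^sub>R v x + t *\<^sub>R v y)"
      using sum_uv xy by (simp add: algebra_simps)
    moreover have "s *\<^sub>R u x + t *\<^sub>R u y \<in> span (u ` C)" "s *\<^sub>R v x + t *\<^sub>R v y \<in> span (v ` C)"
      using xy by (auto intro!: span_add span_scale intro: span_base)
    ultimately have "s *\<^sub>R u x + t *\<^sub>R u y = u w" "s *\<^sub>R v x + t *\<^sub>R v y = v w"
      using uv_unique w(1) by blast+
    then show "s *\<^sub>R u x + t *\<^sub>R u y \<in> u ` C" "s *\<^sub>R v x + t *\<^sub>R v y \<in> v ` C"
      using w(1) by simp_all
  qed
  have "convex (u ` C)" "convex (v ` C)"
    by (rule convexI; clarify; rule lin; simp)+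
  moreover have "c *\<^sub>R u x \<in> u ` C" "c *\<^sub>R v x \<in> v ` C" if "x \<in> C" "c > 0" for c x
    using lin[OF that(1,1), of c 0] that by simp_all
  ultimately show "pos_convex_cone (u ` C)" "pos_convex_cone (v ` C)"
    unfolding pos_convex_cone_def using dom.nonempty by blast+
  show "C' = u ` C + v ` C"
  proof (intro equalityI subsetI)
    fix z assume "z \<in> C'"
    then obtain x where "x \<in> C" "z = \<phi> x" using surj by blast
    then show "z \<in> u ` C + v ` C" using sum_uv by (auto intro!: set_plus_intro)
  next
    fix z assume "z \<in> u ` C + v ` C"
    then obtain x y where xy: "x \<in> C" "y \<in> C" "z = u x + v y" by (auto elim!: set_plus_elim)
    obtain K where K: "K \<ge> 1" "K *\<^sub>R u x - u y \<in> closure C'" using comparable xy by metis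
    \<comment> \<open>This sum equals \<open>u x + v y\<close>: it exceeds the point
      \<open>\<phi> y / K\<close> of \<open>C'\<close> by elements of the closure, as
      \<open>K \<ge> 1\<close>.\<close>
    have "inverse K *\<^sub>R \<phi> y + (inverse K *\<^sub>R (K *\<^sub>R u x - u y) + (1 - inverse K) *\<^sub>R v y) \<in> C'"
      using K xy
      by (intro cod.add_closure cod.closure_add cod.closure_scale cod.scale image_in v_in)
        (auto simp: field_simps)
    then show "z \<in> C'" using sum_uv xy K by (simp add: algebra_simps)
  qed
qed

end

section \<open>Splitting the isometry over both decompositions\<close>

theorem theorem1p5:
  fixes V C :: "'a::euclidean_space set"
    and V' C' :: "'b::euclidean_space set"
    and \<phi> :: "'a \<Rightarrow> 'b"
  assumes "subspace V" and "proper_open_cone V C"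
    and "subspace V'" and "proper_open_cone V' C'"
    and "thompson_isometry C C' \<phi>" and "\<phi> ` C = C'"
  shows "\<exists>C1 C2 C1' C2' \<phi>1 \<phi>2.
           direct_product C C1 C2 \<and>
           direct_product C' C1' C2' \<and>
           proper_open_cone (span C1) C1 \<and> proper_open_cone (span C2) C2 \<and>
           proper_open_cone (span C1') C1' \<and> proper_open_cone (span C2') C2' \<and>
           gauge_preserving C1 C1' \<phi>1 \<and>
           gauge_reversing C2 C2' \<phi>2 \<and>
           (\<forall>x1\<in>C1. \<forall>x2\<in>C2. \<phi> (x1 + x2) = \<phi>1 x1 + \<phi>2 x2)"
proof -
  interpret isometry V C V' C' \<phi> using assms by unfold_locales
  interpret inv: isometry V' C' V C "inv_into C \<phi>" by (rule inverse_isometry)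
  \<comment> \<open>The components of the inverse isometry decompose the source, those of
    \<open>\<phi>\<close> the target.\<close>
  define C1 C2 C1' C2' where "C1 = inv.u ` C'" and "C2 = inv.v ` C'"
    and "C1' = u ` C" and "C2' = v ` C"
  interpret P: cone_product V C C1 C2
    by unfold_locales (simp add: C1_def C2_def inv.codomain_product)
  interpret P': cone_product V' C' C1' C2'
    by unfold_locales (simp add: C1'_def C2'_def codomain_product)
  interpret Q: cone_product V C C2 C1 by (rule P.swap)
  interpret Q': cone_product V' C' C2' C1' by (rule P'.swap)

  have uC: "u x \<in> C1'" and vC: "v x \<in> C2'" if "x \<in> C" for x
    using that by (auto simp: C1'_def C2'_def)

  \<comment> \<open>The inverse sends \<open>l \<phi> (x1 + x2)\<close> to
    \<open>l x1 + x2 / l\<close>, so \<open>\<phi>\<close> maps that point to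
    \<open>l u + l v\<close>; a further scaling by \<open>m\<close> follows \<open>ray\<close>.
    Together they scale the two components independently.\<close>
  have scaled: "a *\<^sub>R x1 + b *\<^sub>R x2 \<in> C \<and> \<phi> (a *\<^sub>R x1 + b *\<^sub>R x2) = a *\<^sub>R u (x1 + x2) + inverse b *\<^sub>R v (x1 + x2)"
    if x: "x1 \<in> C1" "x2 \<in> C2" and ab: "a > 0" "b > 0" for x1 x2 a b
  proof -
    \<comment> \<open>The solution of \<open>m l = a\<close> and \<open>m / l = b\<close>.\<close>
    define l m where "l = sqrt (a / b)" and "m = sqrt (a * b)"
    have lm: "l > 0" "m > 0" "m * l = a" "m * inverse l = b" "inverse m * l = inverse b"
      using ab by (auto simp: l_def m_def real_sqrt_mult real_sqrt_divide field_simps)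
    have xC: "x1 + x2 \<in> C" using x P.sum_in by blast
    let ?x = "x1 + x2" and ?y = "l *\<^sub>R x1 + inverse l *\<^sub>R x2"
    have "inv_into C \<phi> (\<phi> ?x) = x1 + x2" using xC inj by simp
    moreover have "x1 \<in> span (inv.u ` C')" "x2 \<in> span (inv.v ` C')"
      using x by (auto simp only: C1_def C2_def intro: span_base)
    ultimately have "inv.u (\<phi> ?x) = x1" "inv.v (\<phi> ?x) = x2"
      using inv.uv_unique[of x1 x2 "\<phi> ?x"] image_in[OF xC] by simp_all
    then have "inv_into C \<phi> (l *\<^sub>R \<phi> ?x) = ?y"
      using inv.ray[OF image_in[OF xC] lm(1)] by simp
    moreover have "l *\<^sub>R \<phi> ?x \<in> C'" using lm xC cod.scale image_in by blast
    ultimately have y: "?y \<in> C" "\<phi> ?y = l *\<^sub>R \<phi> ?x"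
      using inv.image_in surj by (metis, metis f_inv_into_f)
    have "\<phi> ?y = l *\<^sub>R u ?x + l *\<^sub>R v ?x" using y sum_uv[OF xC] by (simp add: scaleR_add_right)
    moreover have "l *\<^sub>R u ?x \<in> span (u ` C)" "l *\<^sub>R v ?x \<in> span (v ` C)"
      using xC by (simp_all add: span_base span_scale)
    ultimately have uv: "u ?y = l *\<^sub>R u ?x" "v ?y = l *\<^sub>R v ?x"
      using uv_unique[of "l *\<^sub>R u ?x" "l *\<^sub>R v ?x" ?y] y(1) by simp_all
    have "m *\<^sub>R ?y = (m * l) *\<^sub>R x1 + (m * inverse l) *\<^sub>R x2" by (simp add: scaleR_add_right)
    then have my: "m *\<^sub>R ?y = a *\<^sub>R x1 + b *\<^sub>R x2" using lm by simp
    have "\<phi> (m *\<^sub>R ?y) = (m * l) *\<^sub>R u ?x + (inverse m * l) *\<^sub>R v ?x"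
      using ray[OF y(1) lm(2)] by (simp add: uv)
    then have "\<phi> (m *\<^sub>R ?y) = a *\<^sub>R u ?x + inverse b *\<^sub>R v ?x" using lm by simp
    then show ?thesis using my dom.scale[OF y(1) lm(2)] by simp
  qed

  \<comment> \<open>This is \<open>close_iff\<close> for \<open>a x1 + b x2\<close> and
    \<open>y1 + y2\<close>, split by the product order in both cones.\<close>
  have close: "(l *\<^sub>R y1 - a *\<^sub>R x1 \<in> closure C \<and> l *\<^sub>R (a *\<^sub>R x1) - y1 \<in> closure C \<and>
       l *\<^sub>R y2 - b *\<^sub>R x2 \<in> closure C \<and> l *\<^sub>R (b *\<^sub>R x2) - y2 \<in> closure C) \<longleftrightarrow>
      (l *\<^sub>R u (y1 + y2) - a *\<^sub>R u (x1 + x2) \<in> closure C' \<and> l *\<^sub>R (a *\<^sub>R u (x1 + x2)) - u (y1 + y2) \<in> closure C' \<and>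
       l *\<^sub>R v (y1 + y2) - inverse b *\<^sub>R v (x1 + x2) \<in> closure C' \<and>
       l *\<^sub>R (inverse b *\<^sub>R v (x1 + x2)) - v (y1 + y2) \<in> closure C')"
    if x: "x1 \<in> C1" "x2 \<in> C2" and y: "y1 \<in> C1" "y2 \<in> C2" and ab: "a > 0" "b > 0" "l \<ge> 1"
    for x1 x2 y1 y2 a b l
  proof -
    let ?x = "x1 + x2" and ?y = "y1 + y2" and ?z = "a *\<^sub>R x1 + b *\<^sub>R x2"
    have in_C: "?x \<in> C" "?y \<in> C" using x y P.sum_in by auto
    have z: "?z \<in> C" "\<phi> ?z = a *\<^sub>R u ?x + inverse b *\<^sub>R v ?x" using scaled x ab by blast+
    have split: "c *\<^sub>R (p + q) - d *\<^sub>R (r + s) \<in> closure C \<longleftrightarrow>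
        c *\<^sub>R p - d *\<^sub>R r \<in> closure C \<and> c *\<^sub>R q - d *\<^sub>R s \<in> closure C"
      if "p \<in> span C1" "q \<in> span C2" "r \<in> span C1" "s \<in> span C2" for p q r s c d
      using P.closure_sum_iff[of "c *\<^sub>R p - d *\<^sub>R r" "c *\<^sub>R q - d *\<^sub>R s"] that
      by (simp add: span_diff span_scale algebra_simps)
    have split': "c *\<^sub>R (p + q) - d *\<^sub>R (r + s) \<in> closure C' \<longleftrightarrow>
        c *\<^sub>R p - d *\<^sub>R r \<in> closure C' \<and> c *\<^sub>R q - d *\<^sub>R s \<in> closure C'"
      if "p \<in> span C1'" "q \<in> span C2'" "r \<in> span C1'" "s \<in> span C2'" for p q r s c d
      using P'.closure_sum_iff[of "c *\<^sub>R p - d *\<^sub>R r" "c *\<^sub>R q - d *\<^sub>R s"] that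
      by (simp add: span_diff span_scale algebra_simps)
    have sp: "x1 \<in> span C1" "x2 \<in> span C2" "y1 \<in> span C1" "y2 \<in> span C2"
      "a *\<^sub>R x1 \<in> span C1" "b *\<^sub>R x2 \<in> span C2" using x y by (auto intro: span_base span_scale)
    have sp': "u ?y \<in> span C1'" "v ?y \<in> span C2'"
      "a *\<^sub>R u ?x \<in> span C1'" "inverse b *\<^sub>R v ?x \<in> span C2'"
      using in_C uC vC by (auto intro: span_base span_scale)
    have "l *\<^sub>R ?y - 1 *\<^sub>R ?z \<in> closure C \<and> l *\<^sub>R ?z - 1 *\<^sub>R ?y \<in> closure C \<longleftrightarrow>
        l *\<^sub>R (u ?y + v ?y) - 1 *\<^sub>R (a *\<^sub>R u ?x + inverse b *\<^sub>R v ?x) \<in> closure C' \<and>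
        l *\<^sub>R (a *\<^sub>R u ?x + inverse b *\<^sub>R v ?x) - 1 *\<^sub>R (u ?y + v ?y) \<in> closure C'"
      using close_iff[OF z(1) in_C(2) ab(3)] unfolding z(2) sum_uv[OF in_C(2)] by simp
    then show ?thesis
      unfolding split[OF sp(3,4,5,6)] split[OF sp(5,6,3,4)]
        split'[OF sp'(1,2,3,4)] split'[OF sp'(3,4,1,2)] by auto
  qed

  \<comment> \<open>Single relations are extracted from the four in \<open>close\<close>: the
    direction is kept in the first component and reversed in the second.\<close>
  have main: "(t *\<^sub>R y1 - x1 \<in> closure C \<longleftrightarrow> t *\<^sub>R u (y1 + y2) - u (x1 + x2) \<in> closure C') \<and>
      (t *\<^sub>R y2 - x2 \<in> closure C \<longleftrightarrow> t *\<^sub>R v (x1 + x2) - v (y1 + y2) \<in> closure C')"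
    if x: "x1 \<in> C1" "x2 \<in> C2" and y: "y1 \<in> C1" "y2 \<in> C2" and t: "t > 0"
    for x1 x2 y1 y2 t
  proof -
    let ?x = "x1 + x2" and ?y = "y1 + y2"
    have in_C: "?x \<in> C" "?y \<in> C" using x y P.sum_in by auto
    have "\<exists>K. \<forall>l\<ge>K. l *\<^sub>R y1 - x1 \<in> closure C \<and> l *\<^sub>R x1 - y1 \<in> closure C \<and>
        l *\<^sub>R y2 - x2 \<in> closure C \<and> l *\<^sub>R x2 - y2 \<in> closure C \<and>
        l *\<^sub>R u ?y - u ?x \<in> closure C' \<and> l *\<^sub>R u ?x - u ?y \<in> closure C' \<and>
        l *\<^sub>R v ?y - v ?x \<in> closure C' \<and> l *\<^sub>R v ?x - v ?y \<in> closure C'"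
    proof -
      obtain k1 k2 k3 k4 where
        "\<And>l. l \<ge> k1 \<Longrightarrow> l *\<^sub>R y1 - x1 \<in> closure C" "\<And>l. l \<ge> k2 \<Longrightarrow> l *\<^sub>R x1 - y1 \<in> closure C"
        "\<And>l. l \<ge> k3 \<Longrightarrow> l *\<^sub>R y2 - x2 \<in> closure C" "\<And>l. l \<ge> k4 \<Longrightarrow> l *\<^sub>R x2 - y2 \<in> closure C"
        using P.factor_absorb[OF y(1) x(1)] P.factor_absorb[OF x(1) y(1)]
          Q.factor_absorb[OF y(2) x(2)] Q.factor_absorb[OF x(2) y(2)] by metis
      moreover obtain k5 k6 k7 k8 where
        "\<And>l. l \<ge> k5 \<Longrightarrow> l *\<^sub>R u ?y - u ?x \<in> closure C'" "\<And>l. l \<ge> k6 \<Longrightarrow> l *\<^sub>R u ?x - u ?y \<in> closure C'"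
        "\<And>l. l \<ge> k7 \<Longrightarrow> l *\<^sub>R v ?y - v ?x \<in> closure C'" "\<And>l. l \<ge> k8 \<Longrightarrow> l *\<^sub>R v ?x - v ?y \<in> closure C'"
        using P'.factor_absorb[OF uC uC, OF in_C] P'.factor_absorb[OF uC uC, OF in_C(2,1)]
          Q'.factor_absorb[OF vC vC, OF in_C] Q'.factor_absorb[OF vC vC, OF in_C(2,1)] by metis
      ultimately show ?thesis
        by (intro exI[of _ "Max {k1,k2,k3,k4,k5,k6,k7,k8}"]) simp
    qed
    then obtain K where K: "\<And>l. l \<ge> K \<Longrightarrow> l *\<^sub>R y1 - x1 \<in> closure C \<and> l *\<^sub>R x1 - y1 \<in> closure C \<and>
        l *\<^sub>R y2 - x2 \<in> closure C \<and> l *\<^sub>R x2 - y2 \<in> closure C \<and>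
        l *\<^sub>R u ?y - u ?x \<in> closure C' \<and> l *\<^sub>R u ?x - u ?y \<in> closure C' \<and>
        l *\<^sub>R v ?y - v ?x \<in> closure C' \<and> l *\<^sub>R v ?x - v ?y \<in> closure C'" by blast
    txt \<open>With the scaling \<open>a\<close> below, on each side of \<open>close\<close> only the inequality with factor \<open>t\<close>
      can fail; the other three hold since \<open>l\<close> is large.\<close>
    define l where "l = Max {1, K, K * t, t}"
    have l: "l \<ge> 1" "l \<ge> K" "l \<ge> K * t" "l \<ge> t" by (auto simp: l_def)
    define a where "a = l / t"
    have a: "a > 0" using l t by (simp add: a_def)
    \<comment> \<open>Some relations carry the factor \<open>l a\<close> instead of
      \<open>l\<close>; \<open>l \<ge> K t\<close> and \<open>l \<ge> 1\<close> make it at least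
      \<open>K\<close> too.\<close>
    have "K \<le> l / t" using l t by (simp add: le_divide_eq)
    also have "l / t \<le> l * a" using l t by (simp add: a_def divide_right_mono)
    finally have la: "l * a \<ge> K" .
    have drop_scale: "l *\<^sub>R p - a *\<^sub>R q = a *\<^sub>R (t *\<^sub>R p - q)" for p q :: "'c::real_vector"
      using t by (simp add: a_def scaleR_diff_right)
    have ratio: "l * inverse a = t" using l t by (simp add: a_def)
    have inverse_bound: "l *\<^sub>R p - inverse a *\<^sub>R q = inverse a *\<^sub>R ((l * a) *\<^sub>R p - q)" for p q :: "'c::real_vector"
      using a by (simp add: scaleR_diff_right)
    show ?thesis
    proof
      show "t *\<^sub>R y1 - x1 \<in> closure C \<longleftrightarrow> t *\<^sub>R u ?y - u ?x \<in> closure C'"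
        using close[OF x y a zero_less_one l(1)] K[OF l(2)] K[OF la]
        by (simp add: drop_scale dom.closure_scale_iff cod.closure_scale_iff a)
      \<comment> \<open>Scaling \<open>x2\<close> by \<open>a\<close> scales \<open>v ?x\<close> by
        \<open>1/a\<close>. The relation with factor \<open>l / a = t\<close> is therefore the one
        with \<open>v ?x\<close> and \<open>v ?y\<close> exchanged, which is the source of the
        reversal.\<close>
      show "t *\<^sub>R y2 - x2 \<in> closure C \<longleftrightarrow> t *\<^sub>R v ?x - v ?y \<in> closure C'"
        using close[OF x y zero_less_one a l(1)] K[OF l(2)] K[OF la]
        by (simp add: drop_scale ratio inverse_bound
            dom.closure_scale_iff cod.closure_scale_iff a)
    qed
  qed

  obtain c1 c2 where c: "c1 \<in> C1" "c2 \<in> C2"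
    using P.cone1 P.cone2 by (auto simp: pos_convex_cone_def)
  \<comment> \<open>As shown at the end, \<open>u\<close> depends only on the first component and
    \<open>v\<close> only on the second, so any base points \<open>c1\<close>, \<open>c2\<close>
    give the same maps.\<close>
  define \<phi>1 \<phi>2 where "\<phi>1 x1 = u (x1 + c2)" and "\<phi>2 x2 = v (c1 + x2)" for x1 x2
  have in1: "\<phi>1 x1 \<in> C1'" if "x1 \<in> C1" for x1
    using that c P.sum_in uC by (simp add: \<phi>1_def)
  have in2: "\<phi>2 x2 \<in> C2'" if "x2 \<in> C2" for x2
    using that c P.sum_in vC by (simp add: \<phi>2_def)
  have diff: "s *\<^sub>R p - q \<in> span A" if "p \<in> A" "q \<in> A" for s p q and A :: "'c::real_vector set"
    using that by (intro span_diff span_scale span_base)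
  have "gauge_preserving C1 C1' \<phi>1"
    unfolding gauge_preserving_def
  proof (intro conjI ballI Pi_I in1 gauge_M_cong)
    fix x y and t :: real assume xy: "x \<in> C1" "y \<in> C1" and t: "t > 0"
    have "t *\<^sub>R y - x \<in> closure C \<longleftrightarrow> t *\<^sub>R \<phi>1 y - \<phi>1 x \<in> closure C'"
      using main[OF xy(1) c(2) xy(2) c(2) t] by (simp add: \<phi>1_def)
    then show "t *\<^sub>R \<phi>1 y - \<phi>1 x \<in> closure C1' \<longleftrightarrow> t *\<^sub>R y - x \<in> closure C1"
      using P.closure_factor_iff[OF diff[OF xy(2,1)]]
        P'.closure_factor_iff[OF diff[OF in1[OF xy(2)] in1[OF xy(1)]]] by simp
  qed
  moreover have "gauge_reversing C2 C2' \<phi>2"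
    unfolding gauge_reversing_def
  proof (intro conjI ballI Pi_I in2 gauge_M_cong)
    fix x y and t :: real assume xy: "x \<in> C2" "y \<in> C2" and t: "t > 0"
    have "t *\<^sub>R x - y \<in> closure C \<longleftrightarrow> t *\<^sub>R \<phi>2 y - \<phi>2 x \<in> closure C'"
      using main[OF c(1) xy(2) c(1) xy(1) t] by (simp add: \<phi>2_def)
    then show "t *\<^sub>R \<phi>2 y - \<phi>2 x \<in> closure C2' \<longleftrightarrow> t *\<^sub>R x - y \<in> closure C2"
      using Q.closure_factor_iff[OF diff[OF xy]]
        Q'.closure_factor_iff[OF diff[OF in2[OF xy(2)] in2[OF xy(1)]]] by simp
  qed
  moreover have "\<phi> (x1 + x2) = \<phi>1 x1 + \<phi>2 x2" if x: "x1 \<in> C1" "x2 \<in> C2" for x1 x2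
  proof -
    \<comment> \<open>With equal first components, \<open>main\<close> at \<open>t = 1\<close> has
      the trivial relation \<open>0 \<in> closure C\<close> on its left in both directions;
      antisymmetry then gives equality. The same works for \<open>v\<close>.\<close>
    have "u (x1 + x2) = u (x1 + c2)"
      using main[OF x x(1) c(2), of 1] main[OF x(1) c(2) x, of 1] dom.zero_in_closure
      by (intro cod.closure_antisym) auto
    moreover have "v (x1 + x2) = v (c1 + x2)"
      using main[OF x c(1) x(2), of 1] main[OF c(1) x(2) x, of 1] dom.zero_in_closure
      by (intro cod.closure_antisym) auto
    ultimately show ?thesis using sum_uv P.sum_in[OF x] by (simp add: \<phi>1_def \<phi>2_def)
  qed
  ultimately show ?thesis
    using P.product P'.product P.factor_proper Q.factor_proper P'.factor_proper Q'.factor_proper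
    by blast
qed

end
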